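(* Let $A,B$ be $n\times n$ Hermitian positive definite matrices, and let $\gamma(t):=A^{1/2}(A^{-1/2}BA^{-1/2})^tA^{1/2}$ for $t\in[0,1]$. Then $$\delta_S^2(A,\gamma(t))\le t\,\delta_S^2(A,B),\qquad 0\le t\le 1.$$
   Context: For Hermitian positive definite $X,Y$: $\delta_S^2(X,Y):=\log\det\left(\frac{X+Y}{2}\right)-\frac12\log\det(XY)$. *)

theory Defs
  imports "Jordan_Normal_Form.Schur_Decomposition"
begin

definition hermitian :: "complex mat \<Rightarrow> bool" where
  "hermitian A \<longleftrightarrow> square_mat A \<and> mat_adjoint A = A"

definition unitary :: "complex mat \<Rightarrow> bool" where
  "unitary U \<longleftrightarrow> square_mat U \<and> inverts_mat U (mat_adjoint U)"

text \<open>\<open>(A *\<^sub>v v) \<bullet>c v\<close> is $v^* A v$, which is real for Hermitian \<open>A\<close>,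
  so taking \<open>Re\<close> loses nothing.\<close>
definition positive_definite :: "complex mat \<Rightarrow> bool" where
  "positive_definite A \<longleftrightarrow> hermitian A \<and>
     (\<forall>v \<in> carrier_vec (dim_row A). v \<noteq> 0\<^sub>v (dim_row A) \<longrightarrow> 0 < Re ((A *\<^sub>v v) \<bullet>c v))"

definition spectral_decomposition :: "complex mat \<Rightarrow> complex mat \<Rightarrow> (nat \<Rightarrow> real) \<Rightarrow> bool" where
  "spectral_decomposition A U d \<longleftrightarrow>
     U \<in> carrier_mat (dim_row A) (dim_row A) \<and> unitary U \<and>
     A = U * mat_diag (dim_row A) (\<lambda>i. complex_of_real (d i)) * mat_adjoint U"

text \<open>The power $A^t = U \mathrm{diag}(d_i^t) U^*$ of a positive definite matrix
  $A = U \mathrm{diag}(d_i) U^*$ (functional calculus). Independence of the choice of the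
  decomposition is \<open>mat_powr_eq\<close> below.\<close>
definition mat_powr :: "complex mat \<Rightarrow> real \<Rightarrow> complex mat" where
  "mat_powr A t = (THE C. \<exists>U d. spectral_decomposition A U d \<and>
     C = U * mat_diag (dim_row A) (\<lambda>i. complex_of_real (d i powr t)) * mat_adjoint U)"

lemma mat_adjoint_carrier:
  assumes "U \<in> carrier_mat n n"
  shows "mat_adjoint U \<in> carrier_mat n n"
  using assms unfolding mat_adjoint_def carrier_mat_def by auto

lemma unitary_carrierD:
  assumes "unitary U" "U \<in> carrier_mat n n"
  shows "U * mat_adjoint U = 1\<^sub>m n" "mat_adjoint U * U = 1\<^sub>m n"
proof -
  show *: "U * mat_adjoint U = 1\<^sub>m n"
    using assms unfolding unitary_def inverts_mat_def by auto
  show "mat_adjoint U * U = 1\<^sub>m n"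
    by (rule mat_mult_left_right_inverse[OF assms(2) mat_adjoint_carrier[OF assms(2)] *])
qed

lemma functional_calculus_unique:
  fixes d e :: "nat \<Rightarrow> real" and f :: "real \<Rightarrow> real"
  assumes U: "spectral_decomposition A U d" and V: "spectral_decomposition A V e"
  defines "n \<equiv> dim_row A"
  shows "U * mat_diag n (\<lambda>i. complex_of_real (f (d i))) * mat_adjoint U =
         V * mat_diag n (\<lambda>i. complex_of_real (f (e i))) * mat_adjoint V"
proof -
  define U' V' where "U' = mat_adjoint U" and "V' = mat_adjoint V"
  define D where "D g = mat_diag n (\<lambda>i. complex_of_real (g i))" for g
  have Uc: "U \<in> carrier_mat n n" and Vc: "V \<in> carrier_mat n n"
    using U V unfolding spectral_decomposition_def n_def by auto
  note cs = Uc Vc mat_adjoint_carrier[OF Uc, folded U'_def] mat_adjoint_carrier[OF Vc, folded V'_def]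
  have Dc: "D g \<in> carrier_mat n n" for g unfolding D_def by simp
  have UU: "U * U' = 1\<^sub>m n" "U' * U = 1\<^sub>m n" and VV: "V * V' = 1\<^sub>m n" "V' * V = 1\<^sub>m n"
    using U V unitary_carrierD Uc Vc unfolding spectral_decomposition_def U'_def V'_def by auto
  have eq: "U * D d * U' = V * D e * V'"
    using U V unfolding spectral_decomposition_def D_def n_def U'_def V'_def by metis
  define W where "W = V' * U"
  have Wc: "W \<in> carrier_mat n n" unfolding W_def using cs by auto
  have l: "V' * (U * D g * U') * U = W * D g" for g
  proof -
    have "V' * (U * D g * U') * U = W * D g * (U' * U)"
      unfolding W_def using cs Dc[of g]
      by (smt (verit, ccfv_threshold) assoc_mult_mat mult_carrier_mat)
    thus ?thesis using UU Wc Dc[of g] by (metis mult_carrier_mat right_mult_one_mat)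
  qed
  have r: "V' * (V * D g * V') * U = D g * W" for g
  proof -
    have "V' * (V * D g * V') * U = (V' * V) * D g * W"
      unfolding W_def using cs Dc[of g]
      by (smt (verit, ccfv_threshold) assoc_mult_mat mult_carrier_mat)
    thus ?thesis using VV Dc[of g] by (metis left_mult_one_mat)
  qed
  have "W * D d = D e * W" using l[of d] r[of e] eq by simp
  hence ent: "W $$ (i,j) * d j = e i * W $$ (i,j)" if "i < n" "j < n" for i j
    using that Wc mat_diag_mult_left[OF Wc, of "\<lambda>i. complex_of_real (e i)"]
      mat_diag_mult_right[OF Wc, of "\<lambda>i. complex_of_real (d i)"]
    unfolding D_def by (metis (mono_tags, lifting) case_prod_conv index_mat(1))
  have "W * D (f \<circ> d) = D (f \<circ> e) * W"
  proof -
    have "W $$ (i,j) * complex_of_real (f (d j)) = complex_of_real (f (e i)) * W $$ (i,j)"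
      if "i < n" "j < n" for i j
      using ent[OF that] by (cases "W $$ (i,j) = 0") auto
    thus ?thesis unfolding D_def comp_def
      by (subst mat_diag_mult_left[OF Wc], subst mat_diag_mult_right[OF Wc]) (auto intro!: eq_matI)
  qed
  hence "V' * (U * D (f \<circ> d) * U') * U = V' * (V * D (f \<circ> e) * V') * U"
    by (simp only: l r)
  hence "V * (V' * (U * D (f \<circ> d) * U') * U) * U' = V * (V' * (V * D (f \<circ> e) * V') * U) * U'"
    by simp
  moreover have "V * (V' * X * U) * U' = X" if X: "X \<in> carrier_mat n n" for X
  proof -
    have "V * (V' * X * U) * U' = (V * V') * X * (U * U')"
      using cs X by (smt (verit, ccfv_threshold) assoc_mult_mat mult_carrier_mat)
    thus ?thesis using UU VV X by simp
  qed
  moreover have "U * D (f \<circ> d) * U' \<in> carrier_mat n n" "V * D (f \<circ> e) * V' \<in> carrier_mat n n"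
    using cs Dc by (meson mult_carrier_mat)+
  ultimately have "U * D (f \<circ> d) * U' = V * D (f \<circ> e) * V'" by metis
  thus ?thesis unfolding D_def U'_def V'_def comp_def .
qed

lemma mat_powr_eq:
  assumes "spectral_decomposition A U d"
  shows "mat_powr A t =
    U * mat_diag (dim_row A) (\<lambda>i. complex_of_real (d i powr t)) * mat_adjoint U"
  unfolding mat_powr_def
proof (rule the_equality)
  fix C assume "\<exists>U d. spectral_decomposition A U d \<and>
     C = U * mat_diag (dim_row A) (\<lambda>i. complex_of_real (d i powr t)) * mat_adjoint U"
  thus "C = U * mat_diag (dim_row A) (\<lambda>i. complex_of_real (d i powr t)) * mat_adjoint U"
    using functional_calculus_unique[OF assms, where f = "\<lambda>x. x powr t"] by metis
qed (use assms in blast)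

text \<open>For positive definite \<open>X\<close>, \<open>Y\<close> both determinants are positive reals.\<close>
definition delta_S_sq :: "complex mat \<Rightarrow> complex mat \<Rightarrow> real" where
  "delta_S_sq X Y = ln (Re (det ((1/2) \<cdot>\<^sub>m (X + Y)))) - 1/2 * ln (Re (det (X * Y)))"

definition geodesic :: "complex mat \<Rightarrow> complex mat \<Rightarrow> real \<Rightarrow> complex mat" where
  "geodesic A B t =
     mat_powr A (1/2) * mat_powr (mat_powr A (-1/2) * B * mat_powr A (-1/2)) t * mat_powr A (1/2)"

end

theory Submission
  imports Defs "HOL-Analysis.Convex"
begin

text \<open>
  With \<open>P = A\<^sup>1\<^sup>/\<^sup>2\<close> and \<open>M = P\<^sup>-\<^sup>1 B P\<^sup>-\<^sup>1 = V diag(m) V\<^sup>*\<close>, both \<open>B = P M P\<close> and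
  \<open>geodesic A B t = P M\<^sup>t P\<close> are obtained from \<open>A = P P\<close> by inserting a function of \<open>M\<close>. The powers of
  \<open>det A\<close> cancel in \<open>delta_S_sq A (P M\<^sup>t P)\<close>, which is the sum of \<open>ln ((1 + m\<^sub>i\<^sup>t) / 2) - t / 2 * ln m\<^sub>i\<close>.
  The second term is linear in \<open>t\<close>, so it remains to compare the power mean of exponent \<open>t\<close> of
  \<open>1\<close> and \<open>m\<^sub>i\<close> with their arithmetic mean.
\<close>

section \<open>Entrywise calculus of the adjoint\<close>

lemma index_mat_adjoint:
  assumes "i < dim_col A" "j < dim_row A"
  shows "mat_adjoint A $$ (i, j) = conjugate (A $$ (j, i))"
  using assms unfolding mat_adjoint_def by (simp add: mat_of_rows_index)

lemma dim_mat_adjoint [simp]: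
  "dim_row (mat_adjoint A) = dim_col A" "dim_col (mat_adjoint A) = dim_row A"
  unfolding mat_adjoint_def by auto

lemma mat_adjoint_mat_adjoint [simp]: "mat_adjoint (mat_adjoint A) = A"
  by (rule eq_matI) (auto simp: index_mat_adjoint)

lemma mat_adjoint_mult:
  fixes A B :: "complex mat"
  assumes "A \<in> carrier_mat n m" "B \<in> carrier_mat m k"
  shows "mat_adjoint (A * B) = mat_adjoint B * mat_adjoint A"
  using assms
  by (intro eq_matI)
     (auto simp: index_mat_adjoint scalar_prod_def mult.commute intro!: sum.cong)

lemma mat_adjoint_diag:
  "mat_adjoint (mat_diag n f) = mat_diag n (\<lambda>i. conjugate (f i))"
  by (rule eq_matI) (auto simp: index_mat_adjoint mat_diag_def)

lemma mat_adjoint_four_block: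
  assumes "A \<in> carrier_mat n1 m1" "B \<in> carrier_mat n1 m2"
    "C \<in> carrier_mat n2 m1" "D \<in> carrier_mat n2 m2"
  shows "mat_adjoint (four_block_mat A B C D) =
    four_block_mat (mat_adjoint A) (mat_adjoint C) (mat_adjoint B) (mat_adjoint D)"
  using assms by (intro eq_matI) (auto simp: index_mat_adjoint)

lemma mat_adjoint_zero: "mat_adjoint (0\<^sub>m n m) = 0\<^sub>m m n"
  by (rule eq_matI) (auto simp: index_mat_adjoint)

lemma mat_adjoint_one: "mat_adjoint (1\<^sub>m n) = (1\<^sub>m n :: complex mat)"
  by (rule eq_matI) (auto simp: index_mat_adjoint)

lemma mat_adjoint_mult_vec_cscalar_prod:
  fixes S :: "complex mat"
  assumes S: "S \<in> carrier_mat n m" and x: "x \<in> carrier_vec n" and v: "v \<in> carrier_vec m"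
  shows "(mat_adjoint S *\<^sub>v x) \<bullet>c v = x \<bullet>c (S *\<^sub>v v)"
proof -
  have "(mat_adjoint S *\<^sub>v x) \<bullet>c v =
      (\<Sum>i = 0..<m. \<Sum>j = 0..<n. cnj (S $$ (j, i)) * x $ j * cnj (v $ i))"
    using S x v by (auto simp: scalar_prod_def index_mat_adjoint sum_distrib_right intro!: sum.cong)
  also have "\<dots> = (\<Sum>j = 0..<n. \<Sum>i = 0..<m. cnj (S $$ (j, i)) * x $ j * cnj (v $ i))"
    by (rule sum.swap)
  also have "\<dots> = x \<bullet>c (S *\<^sub>v v)"
    using S x v by (auto simp: scalar_prod_def sum_distrib_left ac_simps intro!: sum.cong)
  finally show ?thesis .
qed

section \<open>Congruence of Hermitian and positive definite matrices\<close>

lemma hermitian_congruence: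
  assumes "A \<in> carrier_mat n n" "S \<in> carrier_mat n n" "hermitian A"
  shows "hermitian (mat_adjoint S * A * S)"
proof -
  note S' = mat_adjoint_carrier[OF assms(2)]
  have "mat_adjoint (mat_adjoint S * A * S) = mat_adjoint S * (mat_adjoint A * S)"
    using assms(1,2) S' mat_adjoint_carrier[OF assms(1)]
    by (simp add: mat_adjoint_mult[of _ n n _ n] assoc_mult_mat[of _ n n _ n _ n])
  also have "\<dots> = mat_adjoint S * A * S"
    using assms S' by (simp add: hermitian_def assoc_mult_mat[of _ n n _ n _ n])
  finally show ?thesis using assms by (simp add: hermitian_def)
qed

text \<open>The quadratic form of \<open>mat_adjoint S * A * S\<close> at \<open>v\<close> is that
  of \<open>A\<close> at \<open>S *\<^sub>v v\<close>, and the left inverse \<open>T\<close> keeps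
  this vector nonzero. It is applied both to diagonalize \<open>A\<close> and to pass from
  \<open>B\<close> to the inner matrix of the geodesic.\<close>

lemma positive_definite_congruence:
  assumes A: "A \<in> carrier_mat n n" and S: "S \<in> carrier_mat n n" and T: "T \<in> carrier_mat n n"
    and TS: "T * S = 1\<^sub>m n" and pd: "positive_definite A"
  shows "positive_definite (mat_adjoint S * A * S)"
  unfolding positive_definite_def
proof (intro conjI ballI impI)
  note S' = mat_adjoint_carrier[OF S]
  show "hermitian (mat_adjoint S * A * S)"
    using hermitian_congruence[OF A S] pd by (simp add: positive_definite_def)
  fix v :: "complex vec"
  assume "v \<in> carrier_vec (dim_row (mat_adjoint S * A * S))"
    and "v \<noteq> 0\<^sub>v (dim_row (mat_adjoint S * A * S))"
  hence v: "v \<in> carrier_vec n" "v \<noteq> 0\<^sub>v n" using S by auto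
  have "T *\<^sub>v (S *\<^sub>v v) = v" using TS S T v(1) by (metis assoc_mult_mat_vec one_mult_mat_vec)
  moreover have "T *\<^sub>v 0\<^sub>v n = 0\<^sub>v n" using T by auto
  ultimately have Sv: "S *\<^sub>v v \<in> carrier_vec n" "S *\<^sub>v v \<noteq> 0\<^sub>v n" using v S by auto
  have "((mat_adjoint S * A * S) *\<^sub>v v) \<bullet>c v = (mat_adjoint S *\<^sub>v (A *\<^sub>v (S *\<^sub>v v))) \<bullet>c v"
    using A S S' v(1) by (simp add: assoc_mult_mat_vec[of _ n n _ n])
  also have "\<dots> = (A *\<^sub>v (S *\<^sub>v v)) \<bullet>c (S *\<^sub>v v)"
    using A S v(1) by (intro mat_adjoint_mult_vec_cscalar_prod[of _ n n]) auto
  finally show "0 < Re (((mat_adjoint S * A * S) *\<^sub>v v) \<bullet>c v)"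
    using pd Sv A by (auto simp: positive_definite_def)
qed

section \<open>Unitary matrices with a prescribed first direction\<close>

lemma unitary_of_corthogonal:
  fixes ws :: "complex vec list"
  assumes ws: "set ws \<subseteq> carrier_vec n" "corthogonal ws" "length ws = n"
  shows "\<exists>W c. W \<in> carrier_mat n n \<and> mat_adjoint W * W = 1\<^sub>m n \<and>
    (\<forall>j<n. col W j = c j \<cdot>\<^sub>v ws ! j)"
proof -
  \<comment> \<open>The vectors of \<open>ws\<close> are orthogonal but not normalized, and
    \<open>r j\<close> is the reciprocal of the norm of \<open>ws ! j\<close>. With this scaling the
    Gram matrix of the columns becomes the identity.\<close>
  define r where "r j = 1 / complex_of_real (sqrt (Re (ws ! j \<bullet>c ws ! j)))" for j
  define W where "W = mat_of_cols n (map (\<lambda>j. r j \<cdot>\<^sub>v ws ! j) [0..<n])"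
  have W: "W \<in> carrier_mat n n" unfolding W_def by auto
  have wsn: "ws ! j \<in> carrier_vec n" if "j < n" for j using ws that by auto
  have colW: "col W j = r j \<cdot>\<^sub>v ws ! j" if "j < n" for j
    unfolding W_def using that wsn[OF that] by (subst col_mat_of_cols) auto
  have "(mat_adjoint W * W) $$ (i, j) = (1\<^sub>m n :: complex mat) $$ (i, j)" if ij: "i < n" "j < n" for i j
  proof -
    have "(mat_adjoint W * W) $$ (i, j) = row (mat_adjoint W) i \<bullet> col W j"
      using W ij by auto
    also have "row (mat_adjoint W) i = conjugate (col W i)"
      using W ij by (intro eq_vecI) (auto simp: index_mat_adjoint)
    also have "conjugate (col W i) \<bullet> col W j = col W j \<bullet>c col W i"
      using W by (intro conjugate_vec_sprod_comm[symmetric, of _ n]) auto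
    also have "\<dots> = r j * cnj (r i) * (ws ! j \<bullet>c ws ! i)"
      using wsn[OF ij(1)] wsn[OF ij(2)] by (simp add: colW ij conjugate_smult_vec)
    also have "\<dots> = (if i = j then 1 else 0)"
    proof (cases "i = j")
      case True
      define z where "z = ws ! j \<bullet>c ws ! j"
      \<comment> \<open>In the order on complex numbers, \<open>z \<ge> 0\<close> also forces the
        imaginary part to vanish, so a nonzero \<open>z\<close> is a positive real.\<close>
      have "z \<ge> 0" unfolding z_def by (rule conjugate_square_ge_0_vec)
      moreover have "z \<noteq> 0" using corthogonalD[OF ws(2), of j j] ij ws(3) unfolding z_def by auto
      ultimately have z: "Re z > 0" "z = complex_of_real (Re z)"
        by (auto simp: less_eq_complex_def complex_eq_iff)
      define q where "q = 1 / sqrt (Re z)"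
      have rj: "r j = complex_of_real q" by (simp add: r_def q_def z_def)
      have "r j * cnj (r j) * z = complex_of_real (q * q * Re z)"
        unfolding rj by (subst z(2)) simp
      also have "q * q * Re z = 1" using z(1) by (simp add: q_def)
      finally show ?thesis using True by (simp add: z_def)
    next
      case False
      thus ?thesis using corthogonalD[OF ws(2), of j i] ij ws(3) by auto
    qed
    finally show ?thesis using ij by auto
  qed
  hence "mat_adjoint W * W = 1\<^sub>m n" using W by (intro eq_matI) auto
  thus ?thesis using W colW by blast
qed

text \<open>Complete \<open>v\<close> to a basis and orthogonalize. Gram-Schmidt leaves the first
  vector unchanged, so normalization only rescales \<open>v\<close>; the factor \<open>c\<close> may
  stay unspecified because a multiple of an eigenvector serves equally well later.\<close>

lemma unitary_extension:
  fixes v :: "complex vec"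
  assumes v: "v \<in> carrier_vec n" "v \<noteq> 0\<^sub>v n" and n: "n \<noteq> 0"
  shows "\<exists>W c. W \<in> carrier_mat n n \<and> mat_adjoint W * W = 1\<^sub>m n \<and> col W 0 = c \<cdot>\<^sub>v v"
proof -
  interpret cof_vec_space n "TYPE(complex)" .
  define b where "b = basis_completion v"
  define ws where "ws = gram_schmidt n b"
  note b = basis_completion[OF v, folded b_def]
  obtain vs where bv: "b = v # vs" using b(6,7) n by (cases b) auto
  note gs = gram_schmidt_result[OF b(2,4,5) ws_def]
  have "ws ! 0 = v"
    using gram_schmidt_hd[OF v(1), of vs, folded bv] gs(4) b(6) n
    unfolding ws_def by (metis hd_conv_nth length_0_conv)
  moreover obtain W c where "W \<in> carrier_mat n n" "mat_adjoint W * W = 1\<^sub>m n"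
    "\<forall>j<n. col W j = c j \<cdot>\<^sub>v ws ! j"
    using unitary_of_corthogonal[OF gs(3,2)] gs(4) b(6) by auto
  ultimately show ?thesis using n by auto
qed

lemma complex_mat_has_eigenvector:
  fixes A :: "complex mat"
  assumes A: "A \<in> carrier_mat n n" and n: "n \<noteq> 0"
  shows "\<exists>e v. v \<in> carrier_vec n \<and> v \<noteq> 0\<^sub>v n \<and> A *\<^sub>v v = e \<cdot>\<^sub>v v"
proof -
  obtain as where as: "char_poly A = (\<Prod>a\<leftarrow>as. [:- a, 1:])" "length as = n"
    using char_poly_factorized[OF A] by blast
  obtain e es where "as = e # es" using as(2) n by (cases as) auto
  hence "eigenvalue A e" using as(1) by (simp add: eigenvalue_root_char_poly[OF A])
  thus ?thesis using A by (auto simp: eigenvalue_def eigenvector_def)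
qed


section \<open>The spectral theorem for Hermitian matrices\<close>

lemma unitaryI:
  assumes "W \<in> carrier_mat n n" "mat_adjoint W * W = 1\<^sub>m n"
  shows "unitary W"
  using assms mat_mult_left_right_inverse[OF mat_adjoint_carrier[OF assms(1)] assms]
  by (simp add: unitary_def inverts_mat_def)

lemma hermitian_diagonal_real:
  assumes "hermitian A" "i < dim_row A"
  shows "complex_of_real (Re (A $$ (i, i))) = A $$ (i, i)"
proof -
  have "cnj (A $$ (i, i)) = A $$ (i, i)"
    using assms index_mat_adjoint[of i A i] by (simp add: hermitian_def)
  thus ?thesis by (simp add: complex_eq_iff)
qed

text \<open>Hermitian symmetry carries the zeros of the first column over to the first row and makes
  the corner entry real. This is the deflation step of the spectral theorem.\<close>

lemma hermitian_four_block_of_col: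
  fixes H :: "complex mat"
  assumes H: "H \<in> carrier_mat (Suc n) (Suc n)" and herm: "hermitian H"
    and col: "\<And>i. i < Suc n \<Longrightarrow> i \<noteq> 0 \<Longrightarrow> H $$ (i, 0) = 0"
  shows "\<exists>e K. K \<in> carrier_mat n n \<and> hermitian K \<and>
    H = four_block_mat (mat_diag 1 (\<lambda>_. complex_of_real e)) (0\<^sub>m 1 n) (0\<^sub>m n 1) K"
proof (intro exI conjI)
  define K where "K = mat n n (\<lambda>(i, j). H $$ (Suc i, Suc j))"
  have ent: "H $$ (i, j) = cnj (H $$ (j, i))" if "i < Suc n" "j < Suc n" for i j
    using index_mat_adjoint[of i H j] H herm that by (simp add: hermitian_def)
  show "K \<in> carrier_mat n n" by (simp add: K_def)
  show "hermitian K"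
    unfolding hermitian_def by (auto simp: K_def index_mat_adjoint ent[symmetric] intro!: eq_matI)
  have row: "H $$ (0, j) = 0" if "j < Suc n" "j \<noteq> 0" for j
    using ent[of 0 j] col that by simp
  show "H = four_block_mat (mat_diag 1 (\<lambda>_. complex_of_real (Re (H $$ (0, 0))))) (0\<^sub>m 1 n) (0\<^sub>m n 1) K"
    using H hermitian_diagonal_real[OF herm, of 0]
    by (intro eq_matI) (auto simp: K_def mat_diag_def row col)
qed

text \<open>Induction by deflation: a unitary \<open>W\<close> whose first column is an eigenvector
  splits off one real eigenvalue, the remaining block \<open>K\<close> is diagonalized by
  \<open>V\<close>, and \<open>W\<close> times the block sum of 1 and \<open>V\<close> diagonalizes
  \<open>A\<close>.\<close>

lemma hermitian_spectral_decomposition: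
  assumes "A \<in> carrier_mat n n" "hermitian A"
  shows "\<exists>U d. spectral_decomposition A U d"
  using assms
proof (induction n arbitrary: A)
  case 0
  have "spectral_decomposition A (1\<^sub>m 0) (\<lambda>_. 0)"
    using 0 by (auto simp: spectral_decomposition_def unitary_def inverts_mat_def intro!: eq_matI)
  thus ?case by blast
next
  case (Suc n)
  let ?m = "Suc n"
  note A = \<open>A \<in> carrier_mat ?m ?m\<close>
  obtain e0 v where v: "v \<in> carrier_vec ?m" "v \<noteq> 0\<^sub>v ?m" "A *\<^sub>v v = e0 \<cdot>\<^sub>v v"
    using complex_mat_has_eigenvector[OF A] by auto
  obtain W c where W: "W \<in> carrier_mat ?m ?m" "mat_adjoint W * W = 1\<^sub>m ?m" "col W 0 = c \<cdot>\<^sub>v v"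
    using unitary_extension[OF v(1,2)] by auto
  note W' = mat_adjoint_carrier[OF W(1)]
  have WW': "W * mat_adjoint W = 1\<^sub>m ?m"
    using unitary_carrierD(1)[OF unitaryI[OF W(1,2)] W(1)] .
  define H where "H = mat_adjoint W * A * W"
  have H: "H \<in> carrier_mat ?m ?m" using W by (auto simp: H_def)
  have hermH: "hermitian H" unfolding H_def by (rule hermitian_congruence[OF A W(1) Suc.prems(2)])
  have AW0: "A *\<^sub>v col W 0 = e0 \<cdot>\<^sub>v col W 0"
    using A v W(3) by (simp add: mult_mat_vec smult_smult_assoc mult.commute)
  \<comment> \<open>The entry is \<open>e0\<close> times the inner product of column 0 of
    \<open>W\<close> with column \<open>i\<close>, which vanishes by orthonormality.\<close>
  have "H $$ (i, 0) = 0" if i: "i < ?m" "i \<noteq> 0" for i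
  proof -
    have "H $$ (i, 0) = (mat_adjoint W * (A * W)) $$ (i, 0)"
      using A W W' by (simp add: H_def assoc_mult_mat[of _ ?m ?m _ ?m _ ?m])
    also have "\<dots> = row (mat_adjoint W) i \<bullet> (A *\<^sub>v col W 0)"
      using A W W' i by (subst index_mult_mat) (auto simp: col_mult2[of _ ?m ?m _ ?m] mult_mat_vec_def)
    also have "\<dots> = e0 * (row (mat_adjoint W) i \<bullet> col W 0)"
      unfolding AW0 using W(1) W' i by (intro scalar_prod_smult_distrib[of _ ?m]) (auto intro!: carrier_vecI)
    also have "row (mat_adjoint W) i \<bullet> col W 0 = (mat_adjoint W * W) $$ (i, 0)"
      using W(1) i by simp
    also have "\<dots> = 0" using i unfolding W(2) by simp
    finally show ?thesis by simp
  qed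
  then obtain e K where K: "K \<in> carrier_mat n n" "hermitian K"
    and HK: "H = four_block_mat (mat_diag 1 (\<lambda>_. complex_of_real e)) (0\<^sub>m 1 n) (0\<^sub>m n 1) K"
    using hermitian_four_block_of_col[OF H hermH] by blast
  obtain V d where Vd: "spectral_decomposition K V d" using Suc.IH[OF K] by blast
  have V: "V \<in> carrier_mat n n" "unitary V"
    and KV: "K = V * mat_diag n (\<lambda>i. complex_of_real (d i)) * mat_adjoint V"
    using Vd K by (auto simp: spectral_decomposition_def)
  note V' = mat_adjoint_carrier[OF V(1)]
  define F where "F = four_block_mat (1\<^sub>m 1) (0\<^sub>m 1 n) (0\<^sub>m n 1) V"
  \<comment> \<open>The split-off eigenvalue takes index 0 and the eigenvalues of \<open>K\<close>
    move up by one, matching the block structure of \<open>F\<close>.\<close>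
  define f where "f = case_nat e d"
  have F: "F \<in> carrier_mat ?m ?m" using V unfolding F_def
    using four_block_carrier_mat[of "1\<^sub>m 1" 1 1 V n n] by simp
  have F': "mat_adjoint F = four_block_mat (1\<^sub>m 1) (0\<^sub>m 1 n) (0\<^sub>m n 1) (mat_adjoint V)"
    unfolding F_def using V
    by (subst mat_adjoint_four_block[of _ 1 1 _ n _ n]) (auto simp: mat_adjoint_zero mat_adjoint_one)
  note F'c = mat_adjoint_carrier[OF F]
  have FF: "mat_adjoint F * F = 1\<^sub>m ?m"
    unfolding F' unfolding F_def
    using V V' unitary_carrierD(2)[OF V(2,1)] four_block_one_mat[of 1 n]
    by (subst mult_four_block_mat[of _ 1 1 _ n _ n _ _ 1 _ n]) auto
  have D: "mat_diag ?m (\<lambda>i. complex_of_real (f i)) =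
      four_block_mat (mat_diag 1 (\<lambda>_. complex_of_real e)) (0\<^sub>m 1 n) (0\<^sub>m n 1)
        (mat_diag n (\<lambda>i. complex_of_real (d i)))"
    by (intro eq_matI) (auto simp: f_def mat_diag_def split: nat.split)
  let ?D = "mat_diag ?m (\<lambda>i. complex_of_real (f i))"
  have HF: "H = F * ?D * mat_adjoint F"
  proof -
    have 1: "F * ?D = four_block_mat (mat_diag 1 (\<lambda>_. complex_of_real e)) (0\<^sub>m 1 n) (0\<^sub>m n 1)
        (V * mat_diag n (\<lambda>i. complex_of_real (d i)))"
      unfolding D F_def using V
      by (subst mult_four_block_mat[of _ 1 1 _ n _ n _ _ 1 _ n])
         (auto simp del: One_nat_def simp: left_mult_one_mat[OF mat_diag_dim]
           left_mult_zero_mat[OF mat_diag_dim] right_mult_zero_mat[OF mat_diag_dim])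
    have VD: "V * mat_diag n (\<lambda>i. complex_of_real (d i)) \<in> carrier_mat n n"
      using V by (simp add: mult_carrier_mat[of _ n n _ n])
    show ?thesis
      unfolding 1 F' HK KV
      by (subst mult_four_block_mat[OF mat_diag_dim zero_carrier_mat zero_carrier_mat VD
            one_carrier_mat zero_carrier_mat zero_carrier_mat V'])
         (simp add: right_mult_one_mat[OF mat_diag_dim] right_mult_zero_mat[OF mat_diag_dim]
           left_mult_zero_mat[OF V'] right_mult_zero_mat[OF VD] right_add_zero_mat[of _ n n]
           right_add_zero_mat[of _ 1 1] left_add_zero_mat[of _ n n] mult_carrier_mat[OF VD V']
           del: assoc_mult_mat One_nat_def)
  qed
  note WF' = mat_adjoint_mult[OF W(1) F]
  note assoc = assoc_mult_mat[of _ ?m ?m _ ?m _ ?m] mult_carrier_mat[of _ ?m ?m _ ?m]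
  have "A = (W * mat_adjoint W) * A * (W * mat_adjoint W)" using A WW' by simp
  also have "\<dots> = W * H * mat_adjoint W" using A W(1) W' by (simp add: H_def assoc)
  also have "\<dots> = (W * F) * ?D * mat_adjoint (W * F)"
    unfolding HF WF' using W(1) W' F F'c by (simp add: assoc)
  finally have "A = (W * F) * ?D * mat_adjoint (W * F)" .
  moreover have "unitary (W * F)"
  proof (rule unitaryI)
    have "mat_adjoint (W * F) * (W * F) = mat_adjoint F * ((mat_adjoint W * W) * F)"
      unfolding WF' using W(1) W' F F'c by (simp add: assoc)
    thus "mat_adjoint (W * F) * (W * F) = 1\<^sub>m ?m" unfolding W(2) using F FF by simp
  qed (use W F in auto)
  ultimately have "spectral_decomposition A (W * F) f"
    using A W(1) F by (simp add: spectral_decomposition_def)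
  thus ?case by blast
qed

text \<open>As \<open>U\<close> is unitary, the diagonal matrix is the congruence
  \<open>mat_adjoint U * A * U\<close>, hence positive definite. Its quadratic form at the unit
  vector \<open>i\<close> is \<open>d i\<close>.\<close>

lemma positive_definite_spectrum_pos:
  assumes A: "A \<in> carrier_mat n n" and pd: "positive_definite A"
    and sd: "spectral_decomposition A U d" and i: "i < n"
  shows "0 < d i"
proof -
  let ?D = "mat_diag n (\<lambda>i. complex_of_real (d i))"
  have U: "U \<in> carrier_mat n n" "unitary U" and AU: "A = U * ?D * mat_adjoint U"
    using sd A by (auto simp: spectral_decomposition_def)
  note U' = mat_adjoint_carrier[OF U(1)]
  note UU = unitary_carrierD[OF U(2,1)]
  note assoc = assoc_mult_mat[of _ n n _ n _ n] mult_carrier_mat[of _ n n _ n]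
  have "mat_adjoint U * A * U = (mat_adjoint U * U) * ?D * (mat_adjoint U * U)"
    unfolding AU using U(1) U' by (simp add: assoc)
  also have "\<dots> = ?D" unfolding UU by (simp add: left_mult_one_mat[OF mat_diag_dim] right_mult_one_mat[OF mat_diag_dim])
  finally have "positive_definite ?D"
    using positive_definite_congruence[OF A U(1) U' UU(2) pd] by simp
  hence "0 < Re ((?D *\<^sub>v unit_vec n i) \<bullet>c unit_vec n i)"
    using i by (auto simp: positive_definite_def mat_diag_def)
  also have "?D *\<^sub>v unit_vec n i = complex_of_real (d i) \<cdot>\<^sub>v unit_vec n i"
    using i by (intro eq_vecI) (auto simp: mat_diag_def)
  also have "conjugate (unit_vec n i) = (unit_vec n i :: complex vec)"
    by (intro eq_vecI) (auto simp: unit_vec_def)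
  finally show ?thesis using i by simp
qed

section \<open>Determinants and the divergence in eigenvalue form\<close>

lemma det_mat_diag: "det (mat_diag n f) = (\<Prod>i<n. f i)"
proof -
  have "det (mat_diag n f) = prod_list (diag_mat (mat_diag n f))"
    by (rule det_upper_triangular) (auto simp: mat_diag_def)
  thus ?thesis by (simp add: prod_list_diag_prod mat_diag_def lessThan_atLeast0)
qed

lemma det_unitary_conjugate:
  assumes U: "U \<in> carrier_mat n n" "unitary U" and D: "D \<in> carrier_mat n n"
  shows "det (U * D * mat_adjoint U) = det D"
proof -
  note U' = mat_adjoint_carrier[OF U(1)]
  have "det U * det (mat_adjoint U) = 1"
    using unitary_carrierD(1)[OF U(2,1)] det_mult[OF U(1) U'] by simp
  thus ?thesis using U(1) D U' by (simp add: det_mult[of _ n])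
qed

text \<open>Both arguments and their mean have the form \<open>P * X g * P\<close> for some diagonal
  \<open>g\<close>, with determinant \<open>\<alpha>\<close> times the product of the
  \<open>g i\<close>. Keeping \<open>x\<close> arbitrary lets the lemma serve for \<open>B\<close>,
  with \<open>x = m\<close>, and for the geodesic, with the powers
  \<open>m i powr t\<close>.\<close>

lemma delta_S_sq_congruent_diag:
  fixes x :: "nat \<Rightarrow> real"
  assumes P: "P \<in> carrier_mat n n" and PP: "P * P = A"
    and detA: "det A = complex_of_real \<alpha>" "\<alpha> > 0"
    and V: "V \<in> carrier_mat n n" "unitary V" and x: "\<And>i. i < n \<Longrightarrow> 0 < x i"
  shows "delta_S_sq A (P * (V * mat_diag n (\<lambda>i. complex_of_real (x i)) * mat_adjoint V) * P) =
    (\<Sum>i<n. ln ((1 + x i) / 2) - 1/2 * ln (x i))"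
proof -
  note V' = mat_adjoint_carrier[OF V(1)]
  note assoc = assoc_mult_mat[of _ n n _ n _ n] mult_carrier_mat[of _ n n _ n]
  define D where "D g = mat_diag n (\<lambda>i. complex_of_real (g i))" for g
  have Dc: "D g \<in> carrier_mat n n" for g by (simp add: D_def)
  define X where "X g = V * D g * mat_adjoint V" for g
  have Xc: "X g \<in> carrier_mat n n" for g using V(1) V' Dc unfolding X_def by (simp add: assoc)
  have detPP: "det P * det P = complex_of_real \<alpha>" using det_mult[OF P P] PP detA by simp
  have detX: "det (P * X g * P) = complex_of_real (\<alpha> * (\<Prod>i<n. g i))" for g
  proof -
    have "det (P * X g * P) = (det P * det P) * det (X g)"
      using P Xc by (simp add: det_mult[of _ n])
    thus ?thesis unfolding detPP unfolding X_def det_unitary_conjugate[OF V Dc]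
      by (simp add: D_def det_mat_diag)
  qed
  \<comment> \<open>This writes \<open>A = P * P\<close> as
    \<open>P * X (\<lambda>_. 1) * P\<close>, so that the mean can be taken on the diagonal.\<close>
  have X1: "X (\<lambda>_. 1) = 1\<^sub>m n"
    using unitary_carrierD[OF V(2,1)] V by (simp add: X_def D_def)
  have DD: "(1/2) \<cdot>\<^sub>m (D (\<lambda>_. 1) + D x) = D (\<lambda>i. (1 + x i) / 2)"
    unfolding D_def by (intro eq_matI) (auto simp: mat_diag_def)
  have Ac: "A \<in> carrier_mat n n" using P PP by auto
  have "X (\<lambda>_. 1) + X x = V * (D (\<lambda>_. 1) + D x) * mat_adjoint V"
    unfolding X_def using V(1) V' Dc
    by (simp add: mult_add_distrib_mat[of _ n n _ n] add_mult_distrib_mat[of _ n n _ _ n])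
  hence "(1/2) \<cdot>\<^sub>m (X (\<lambda>_. 1) + X x) = X (\<lambda>i. (1 + x i) / 2)"
    unfolding X_def DD[symmetric] using V(1) V' Dc
    by (simp add: mult_smult_distrib[of _ n n _ n] mult_smult_assoc_mat[of _ n n _ n])
  moreover have "A + P * X x * P = P * (X (\<lambda>_. 1) + X x) * P"
    using P Xc Ac PP X1
    by (simp add: mult_add_distrib_mat[of _ n n _ n] add_mult_distrib_mat[of _ n n _ _ n])
  moreover have "(1/2) \<cdot>\<^sub>m (P * (X (\<lambda>_. 1) + X x) * P) = P * ((1/2) \<cdot>\<^sub>m (X (\<lambda>_. 1) + X x)) * P"
    using P Xc by (simp add: mult_smult_distrib[of _ n n _ n] mult_smult_assoc_mat[of _ n n _ n] assoc)
  ultimately have mid: "(1/2) \<cdot>\<^sub>m (A + P * X x * P) = P * X (\<lambda>i. (1 + x i) / 2) * P"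
    by simp
  have x2: "0 < (1 + x i) / 2" if "i < n" for i using x[OF that] by simp
  have pos: "(\<Prod>i<n. x i) > 0" "(\<Prod>i<n. (1 + x i) / 2) > 0"
    using x x2 by (auto intro!: prod_pos)
  have lnprod: "ln (\<Prod>i<n. x i) = (\<Sum>i<n. ln (x i))"
    "ln (\<Prod>i<n. (1 + x i) / 2) = (\<Sum>i<n. ln ((1 + x i) / 2))"
    using less_imp_neq[OF x] less_imp_neq[OF x2] by (intro ln_prod; force)+
  have "ln (Re (det ((1/2) \<cdot>\<^sub>m (A + P * X x * P)))) = ln (\<alpha> * (\<Prod>i<n. (1 + x i) / 2))"
    unfolding mid detX by (simp only: Re_complex_of_real)
  also have "\<dots> = ln \<alpha> + (\<Sum>i<n. ln ((1 + x i) / 2))"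
    using detA(2) pos(2) lnprod(2) by (simp only: ln_mult_pos)
  finally have 1: "ln (Re (det ((1/2) \<cdot>\<^sub>m (A + P * X x * P)))) = ln \<alpha> + (\<Sum>i<n. ln ((1 + x i) / 2))" .
  have "det (A * (P * X x * P)) = complex_of_real (\<alpha> * (\<alpha> * (\<Prod>i<n. x i)))"
    using P Xc Ac detA detX by (subst det_mult[of _ n]) auto
  hence "ln (Re (det (A * (P * X x * P)))) = ln (\<alpha> * (\<alpha> * (\<Prod>i<n. x i)))"
    by (simp only: Re_complex_of_real)
  also have "\<dots> = 2 * ln \<alpha> + (\<Sum>i<n. ln (x i))"
    using detA(2) pos(1) lnprod(1) by (simp add: ln_mult_pos)
  finally have 2: "ln (Re (det (A * (P * X x * P)))) = 2 * ln \<alpha> + (\<Sum>i<n. ln (x i))" .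
  \<comment> \<open>Half of \<open>2 * ln \<alpha>\<close> from the product cancels the
    \<open>ln \<alpha>\<close> from the mean.\<close>
  have "delta_S_sq A (P * X x * P) =
      (\<Sum>i<n. ln ((1 + x i) / 2)) - 1/2 * (\<Sum>i<n. ln (x i))"
    unfolding delta_S_sq_def 1 2 by (simp add: algebra_simps)
  thus ?thesis
    unfolding X_def D_def by (simp only: sum_subtractf sum_distrib_left)
qed

section \<open>The scalar inequality\<close>

text \<open>The logarithm of the power mean inequality, multiplied by \<open>t\<close> instead of
  using the exponent \<open>1 / t\<close>, so that \<open>t = 0\<close> is included.\<close>

lemma ln_half_one_plus_powr_le:
  fixes m t :: real
  assumes m: "0 < m" and t: "0 \<le> t" "t \<le> 1"
  shows "ln ((1 + m powr t) / 2) \<le> t * ln ((1 + m) / 2)"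
proof -
  define s where "s = (1 + m) / 2"
  have s: "s > 0" using m by (simp add: s_def)
  \<comment> \<open>After scaling by the arithmetic mean \<open>s\<close>, the tangent-line bounds at \<open>1 / s\<close> and \<open>m / s\<close> add up to \<open>2\<close>.\<close>
  have young: "y powr t \<le> t * y + (1 - t)" if "y > 0" for y :: real
    using Youngs_inequality_0[of t "1 - t" y 1] that t by simp
  have "(1 / s) powr t + (m / s) powr t \<le> t * ((1 + m) / s) + 2 * (1 - t)"
    using young[of "1 / s"] young[of "m / s"] s m by (simp add: add_divide_distrib distrib_left)
  also have "\<dots> = 2" using m by (simp add: s_def field_simps)
  finally have "1 + m powr t \<le> 2 * s powr t"
    using s m by (simp add: powr_divide field_simps)
  hence "ln ((1 + m powr t) / 2) \<le> ln (s powr t)"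
    using m s by (intro ln_mono) (auto intro: add_pos_pos)
  thus ?thesis using s by (simp add: ln_powr s_def)
qed

section \<open>Reduction of the theorem to eigenvalues\<close>

theorem theorem4p6:
  fixes n :: nat and A B :: "complex mat" and t :: real
  assumes "A \<in> carrier_mat n n" and "B \<in> carrier_mat n n"
    and "positive_definite A" and "positive_definite B"
    and "0 \<le> t" and "t \<le> 1"
  shows "delta_S_sq A (geodesic A B t) \<le> t * delta_S_sq A B"
proof -
  note A = assms(1) and B = assms(2)
  note assoc = assoc_mult_mat[of _ n n _ n _ n] mult_carrier_mat[of _ n n _ n]
  obtain U a where sdA: "spectral_decomposition A U a"
    using hermitian_spectral_decomposition[OF A] assms(3) by (auto simp: positive_definite_def)
  have a: "0 < a i" if "i < n" for i
    by (rule positive_definite_spectrum_pos[OF A assms(3) sdA that])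
  have U: "U \<in> carrier_mat n n" "unitary U"
    and AU: "A = U * mat_diag n (\<lambda>i. complex_of_real (a i)) * mat_adjoint U"
    using sdA A by (auto simp: spectral_decomposition_def)
  note U' = mat_adjoint_carrier[OF U(1)]
  note UU = unitary_carrierD[OF U(2,1)]
  define R where "R s = mat_powr A s" for s
  have R: "R s = U * mat_diag n (\<lambda>i. complex_of_real (a i powr s)) * mat_adjoint U" for s
    unfolding R_def using mat_powr_eq[OF sdA] A by simp
  have Rc: "R s \<in> carrier_mat n n" for s unfolding R using U(1) U' by (simp add: assoc)
  \<comment> \<open>The exponent law for powers of \<open>A\<close>: the inner
    \<open>mat_adjoint U * U\<close> cancels. It yields \<open>P * P = A\<close> from 1/2 + 1/2 and
    \<open>P * Q = 1\<^sub>m n\<close> from 1/2 - 1/2.\<close>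
  have RR: "R s * R r = U * mat_diag n (\<lambda>i. complex_of_real (a i powr (s + r))) * mat_adjoint U" for s r
  proof -
    have "R s * R r = U * (mat_diag n (\<lambda>i. complex_of_real (a i powr s)) * (mat_adjoint U * U) *
        mat_diag n (\<lambda>i. complex_of_real (a i powr r))) * mat_adjoint U"
      unfolding R using U(1) U' by (simp add: assoc)
    thus ?thesis unfolding UU by (simp add: right_mult_one_mat[OF mat_diag_dim] powr_add)
  qed
  \<comment> \<open>The eigenvalues are known to be positive only at indices below \<open>n\<close>,
    so diagonal matrices are compared entry by entry on that range.\<close>
  have cong_diag: "mat_diag n f = mat_diag n g" if "\<And>i. i < n \<Longrightarrow> f i = g i" for f g :: "nat \<Rightarrow> complex"
    using that by (auto simp: mat_diag_def intro!: eq_matI)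
  define P Q where "P = R (1/2)" and "Q = R (-1/2)"
  have P: "P \<in> carrier_mat n n" and Q: "Q \<in> carrier_mat n n" by (auto simp: P_def Q_def Rc)
  have "mat_diag n (\<lambda>i. complex_of_real (a i powr 1)) = mat_diag n (\<lambda>i. complex_of_real (a i))"
    using a by (intro cong_diag) (simp add: less_imp_le)
  hence PP: "P * P = A" unfolding P_def RR AU by simp
  \<comment> \<open>Positivity of the eigenvalues matters here, because \<open>0 powr 0\<close> is
    0.\<close>
  have "mat_diag n (\<lambda>i. complex_of_real (a i powr 0)) = mat_diag n (\<lambda>i. 1)"
    using less_imp_neq[OF a] by (intro cong_diag) auto
  hence PQ: "P * Q = 1\<^sub>m n" "Q * P = 1\<^sub>m n"
    unfolding P_def Q_def RR using UU U by auto
  \<comment> \<open>Being self-adjoint, \<open>Q\<close> turns \<open>Q * B * Q\<close> into a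
    congruence of \<open>B\<close>, with \<open>P\<close> as the left inverse of
    \<open>Q\<close>.\<close>
  have Q': "mat_adjoint Q = Q"
    unfolding Q_def R using U(1) U'
    by (simp add: mat_adjoint_mult[of _ n n _ n] mat_adjoint_diag assoc)
  define M where "M = Q * B * Q"
  have M: "M \<in> carrier_mat n n" using Q B by (simp add: M_def)
  have pdM: "positive_definite M"
    using positive_definite_congruence[OF B Q P PQ(1) assms(4)] by (simp add: Q' M_def)
  obtain V m where sdM: "spectral_decomposition M V m"
    using hermitian_spectral_decomposition[OF M] pdM by (auto simp: positive_definite_def)
  have m: "0 < m i" if "i < n" for i
    by (rule positive_definite_spectrum_pos[OF M pdM sdM that])
  have V: "V \<in> carrier_mat n n" "unitary V"
    and MV: "M = V * mat_diag n (\<lambda>i. complex_of_real (m i)) * mat_adjoint V"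
    using sdM M by (auto simp: spectral_decomposition_def)
  have detA: "det A = complex_of_real (\<Prod>i<n. a i)"
    unfolding AU det_unitary_conjugate[OF U mat_diag_dim] by (simp add: det_mat_diag)
  have alpha: "(\<Prod>i<n. a i) > 0" using a by (intro prod_pos) auto
  note delta = delta_S_sq_congruent_diag[OF P PP detA alpha V]
  have "B = (P * Q) * B * (Q * P)" using B PQ by simp
  also have "\<dots> = P * M * P" using B P Q by (simp add: M_def assoc)
  finally have "delta_S_sq A B = (\<Sum>i<n. ln ((1 + m i) / 2) - 1/2 * ln (m i))"
    using delta[OF m] unfolding MV by simp
  moreover have "delta_S_sq A (geodesic A B t) =
      (\<Sum>i<n. ln ((1 + m i powr t) / 2) - 1/2 * ln (m i powr t))"
  proof -
    have "geodesic A B t = P * mat_powr M t * P" by (simp add: geodesic_def M_def P_def Q_def R_def)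
    also have "mat_powr M t = V * mat_diag n (\<lambda>i. complex_of_real (m i powr t)) * mat_adjoint V"
      using mat_powr_eq[OF sdM] M by simp
    finally have geo: "geodesic A B t = P * (V * mat_diag n (\<lambda>i. complex_of_real (m i powr t)) * mat_adjoint V) * P" .
    have "0 < m i powr t" if "i < n" for i using m[OF that] by simp
    thus ?thesis unfolding geo by (rule delta)
  qed
  \<comment> \<open>The inequality holds for each eigenvalue separately: the terms
    \<open>1/2 * ln (m i powr t)\<close> and \<open>t * (1/2 * ln (m i))\<close> agree exactly,
    which leaves the scalar lemma.\<close>
  moreover have "ln ((1 + m i powr t) / 2) - 1/2 * ln (m i powr t) \<le>
      t * (ln ((1 + m i) / 2) - 1/2 * ln (m i))" if "i < n" for i
    using ln_half_one_plus_powr_le[OF m[OF that] assms(5,6)] m[OF that]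
    by (simp add: ln_powr right_diff_distrib)
  ultimately show ?thesis
    by (auto simp: sum_distrib_left intro!: sum_mono)
qed

end
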